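(* Let $G$ be a threshold graph on $\{0,1,\dots,n\}$ labeled by reverse degree sequence, with edges directed from $i$ to $j$ when $i>j$, degree sequence $(d_0,\dots,d_n)$, and let $\mathbf a=(a_1,\dots,a_n)\in\mathbb Z_{>0}^n$. Then \[\operatorname{Ehr}_{q,0}(\mathcal F_G(\mathbf a))=\prod_{i=1}^n q^{\bar d_i(a_i-1)}[\bar d_i]_q,\] where $\bar d_i=\min\{d_i,i\}$.
   Context: A threshold graph is built from one vertex by repeatedly adding a dominating vertex or an isolated vertex; labeled by reverse degree sequence means $d_i\ge d_j$ for $i<j$; $\bar d_i$ is the number of neighbors $j<i$ of $i$. $\mathcal F_G(\mathbf a)$ is the set of $x\in\mathbb R_{\ge0}^E$ such that for each vertex $k\ge1$ the flow out of $k$ (on edges to smaller vertices) minus the flow into $k$ equals $a_k$, and the net flow at $0$ is $-\sum a_i$. $wt_{q,t}(b)=\frac{q^b-t^b}{q-t}$ for $b>0$, $wt_{q,t}(0)=1$; for an integer flow $A=(a_{ij})$, $wt_{q,t}(A)=(-(1-t)(1-q))^{\#\{a_{ij}>0\}-n}\prod wt_{q,t}(a_{ij})$; $\operatorname{Ehr}_{q,t}(\mathcal F_G(\mathbf a))=\sum_{A\in\mathcal F_G(\mathbf a)\cap\mathbb Z^E}wt_{q,t}(A)$. $[k]_q=1+q+\dots+q^{k-1}$ (so $[0]_q=0$). *)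

theory Defs
  imports Complex_Main "HOL-Library.FuncSet"
begin

text \<open>A simple graph is given by its vertex set \<open>V\<close> and its set \<open>E\<close> of two-element edges.\<close>

inductive threshold_graph :: "'v set \<Rightarrow> 'v set set \<Rightarrow> bool" where
  single: "threshold_graph {v} {}"
| isolated: "threshold_graph V E \<Longrightarrow> v \<notin> V \<Longrightarrow> threshold_graph (insert v V) E"
| dominating: "threshold_graph V E \<Longrightarrow> v \<notin> V \<Longrightarrow>
    threshold_graph (insert v V) (E \<union> {{u, v} |u. u \<in> V})"

definition degree :: "'v set set \<Rightarrow> 'v \<Rightarrow> nat" where
  "degree E v = card {e \<in> E. v \<in> e}"

definition reverse_degree_labeled :: "nat \<Rightarrow> nat set set \<Rightarrow> bool" where
  "reverse_degree_labeled n E \<longleftrightarrow>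
    (\<forall>i\<in>{0..n}. \<forall>j\<in>{0..n}. i < j \<longrightarrow> degree E i \<ge> degree E j)"

definition dbar :: "nat set set \<Rightarrow> nat \<Rightarrow> nat" where
  "dbar E i = card {j. j < i \<and> {i, j} \<in> E}"

definition arcs :: "nat set set \<Rightarrow> (nat \<times> nat) set" where
  "arcs E = {(i, j). i > j \<and> {i, j} \<in> E}"

definition net_flow :: "nat set set \<Rightarrow> (nat \<times> nat \<Rightarrow> real) \<Rightarrow> nat \<Rightarrow> real" where
  "net_flow E x k =
    (\<Sum>e\<in>{e \<in> arcs E. fst e = k}. x e) - (\<Sum>e\<in>{e \<in> arcs E. snd e = k}. x e)"

text \<open>A vector indexed by the edges is an extensional function on \<open>arcs E\<close>, so that distinct
  functions are distinct points. Only the values \<open>a 1, \<dots>, a n\<close> of \<open>a\<close> matter.\<close>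

definition flow_polytope :: "nat \<Rightarrow> nat set set \<Rightarrow> (nat \<Rightarrow> int) \<Rightarrow> (nat \<times> nat \<Rightarrow> real) set" where
  "flow_polytope n E a =
    {x \<in> arcs E \<rightarrow>\<^sub>E {0..}.
      (\<forall>k\<in>{1..n}. net_flow E x k = of_int (a k)) \<and>
      net_flow E x 0 = - of_int (\<Sum>i=1..n. a i)}"

definition wt :: "'a::field \<Rightarrow> 'a \<Rightarrow> nat \<Rightarrow> 'a" where
  "wt q t b = (if b = 0 then 1 else (q ^ b - t ^ b) / (q - t))"

text \<open>On integer flows, the only ones this is applied to, \<open>nat \<lfloor>A e\<rfloor>\<close> is just the value \<open>A e\<close>.
  The exponent is an integer because it may be negative for a general netflow vector.\<close>

definition wt_flow ::
  "'a::field \<Rightarrow> 'a \<Rightarrow> nat \<Rightarrow> nat set set \<Rightarrow> (nat \<times> nat \<Rightarrow> real) \<Rightarrow> 'a" where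
  "wt_flow q t n E A =
    (- ((1 - t) * (1 - q))) powi (int (card {e \<in> arcs E. A e > 0}) - int n) *
    (\<Prod>e\<in>arcs E. wt q t (nat \<lfloor>A e\<rfloor>))"

definition Ehr :: "'a::field \<Rightarrow> 'a \<Rightarrow> nat \<Rightarrow> nat set set \<Rightarrow> (nat \<Rightarrow> int) \<Rightarrow> 'a" where
  "Ehr q t n E a =
    (\<Sum>A\<in>flow_polytope n E a \<inter> {x. \<forall>e\<in>arcs E. x e \<in> \<int>}. wt_flow q t n E A)"

definition q_int :: "'a::field \<Rightarrow> nat \<Rightarrow> 'a" where
  "q_int q k = (\<Sum>i<k. q ^ i)"

end

theory Submission
  imports Defs "HOL-Library.Ramsey"
begin

text \<open>
  At \<open>t = 0\<close> an edge carrying \<open>b > 0\<close> units has weight \<open>q ^ (b - 1)\<close>. In a threshold graph labeled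
  by reverse degree sequence, the edges out of vertex \<open>k\<close> lead exactly to \<open>0, \<dots>, dbar k - 1\<close>, and
  every \<open>j < dbar k\<close> satisfies \<open>dbar j = j\<close>. Removing the last vertex \<open>n\<close> adds its outflow \<open>x j\<close> to
  \<open>a j\<close>, which by induction multiplies the result for the smaller graph by \<open>q ^ (j * x j)\<close>.
  The sum over the weak compositions \<open>x\<close> of \<open>a n\<close> into \<open>dbar n\<close> parts, weighted in this way, has
  a telescoping generating function and equals the factor belonging to \<open>n\<close>.
\<close>

section \<open>Weighted compositions\<close>

definition support :: "('b \<Rightarrow> nat) \<Rightarrow> 'b set" where
  "support x = {j. 0 < x j}"

lemma support_zero [simp]: "support (\<lambda>_. 0) = {}"
  by (simp add: support_def)

lemma support_eq_empty_iff: "support x = {} \<longleftrightarrow> x = (\<lambda>_. 0)"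
  by (auto simp: support_def fun_eq_iff)

definition weak_compositions :: "'b set \<Rightarrow> nat \<Rightarrow> ('b \<Rightarrow> nat) set" where
  "weak_compositions S b = {x. support x \<subseteq> S \<and> sum x S = b}"

lemma weak_compositions_empty: "b > 0 \<Longrightarrow> weak_compositions {} b = {}"
  by (simp add: weak_compositions_def)

lemma weak_compositions_zero: "finite S \<Longrightarrow> weak_compositions S 0 = {\<lambda>_. 0}"
  by (auto simp: weak_compositions_def support_def subset_iff fun_eq_iff)

lemma weak_compositions_nonzero: "x \<in> weak_compositions S b \<Longrightarrow> b > 0 \<Longrightarrow> x \<noteq> (\<lambda>_. 0)"
  by (auto simp: weak_compositions_def)

lemma bij_betw_weak_compositions_insert:
  assumes "finite S" "s \<notin> S"
  shows "bij_betw (\<lambda>(c, x). x(s := c)) (SIGMA c:{..b}. weak_compositions S (b - c))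
    (weak_compositions (insert s S) b)"
proof (rule bij_betw_byWitness[where f' = "\<lambda>x. (x s, x(s := 0))"])
  have sum_update: "sum (x(s := c)) S = sum x S" for x and c :: nat
    using assms(2) by (intro sum.cong) auto
  show "\<forall>p\<in>SIGMA c:{..b}. weak_compositions S (b - c).
      (\<lambda>x. (x s, x(s := 0))) ((\<lambda>(c, x). x(s := c)) p) = p"
    using assms(2) by (auto simp: weak_compositions_def support_def fun_eq_iff)
  show "(\<lambda>(c, x). x(s := c)) ` (SIGMA c:{..b}. weak_compositions S (b - c))
      \<subseteq> weak_compositions (insert s S) b"
    using assms sum_update by (auto simp: weak_compositions_def support_def split: if_splits)
  show "(\<lambda>x. (x s, x(s := 0))) ` weak_compositions (insert s S) b
      \<subseteq> (SIGMA c:{..b}. weak_compositions S (b - c))"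
    using assms sum_update by (auto simp: weak_compositions_def support_def split: if_splits)
qed auto

lemma finite_weak_compositions: "finite S \<Longrightarrow> finite (weak_compositions S b)"
proof (induction S arbitrary: b rule: finite_induct)
  case empty
  show ?case by (cases b) (simp_all add: weak_compositions_empty weak_compositions_zero)
next
  case (insert s S)
  have "finite (SIGMA c:{..b}. weak_compositions S (b - c))"
    using insert.IH by simp
  then show ?case
    using bij_betw_finite[OF bij_betw_weak_compositions_insert[OF insert.hyps]] by blast
qed

lemma sum_weak_compositions_insert:
  assumes "finite S" "s \<notin> S"
  shows "(\<Sum>x\<in>weak_compositions (insert s S) b. g x) =
    (\<Sum>c\<le>b. \<Sum>x\<in>weak_compositions S (b - c). g (x(s := c)))"
  using sum.reindex_bij_betw[OF bij_betw_weak_compositions_insert[OF assms], of g]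
  by (simp add: sum.Sigma finite_weak_compositions[OF assms(1)] case_prod_unfold)

text \<open>Splitting the exponent \<open>#{a\<^sub>i\<^sub>j > 0} - n\<close> of the flow weight into one exponent \<open>\<dots> - 1\<close> per
  vertex avoids division, so that \<open>q = 1\<close> needs no special treatment. The truncated subtraction
  only matters for the zero composition.\<close>

definition composition_weight :: "'a::comm_semiring_1 \<Rightarrow> ('b \<Rightarrow> nat \<Rightarrow> 'a) \<Rightarrow> ('b \<Rightarrow> nat) \<Rightarrow> 'a" where
  "composition_weight \<kappa> w x = \<kappa> ^ (card (support x) - 1) * (\<Prod>j\<in>support x. w j (x j))"

lemma composition_weight_single:
  assumes "c > 0"
  shows "composition_weight \<kappa> w ((\<lambda>_. 0)(s := c)) = w s c"
proof -
  have "support ((\<lambda>_. 0)(s := c)) = {s}"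
    using assms by (auto simp: support_def)
  then show ?thesis
    by (simp add: composition_weight_def)
qed

lemma composition_weight_update:
  assumes "finite (support x)" "x \<noteq> (\<lambda>_. 0)" "x s = 0" "c > 0"
  shows "composition_weight \<kappa> w (x(s := c)) = \<kappa> * (composition_weight \<kappa> w x * w s c)"
proof -
  have "support (x(s := c)) = insert s (support x)" and s: "s \<notin> support x"
    using assms by (auto simp: support_def)
  moreover have "(\<Prod>j\<in>support x. w j ((x(s := c)) j)) = (\<Prod>j\<in>support x. w j (x j))"
    using s by (intro prod.cong) auto
  moreover have "card (support x) > 0"
    using assms by (simp add: card_gt_0_iff support_eq_empty_iff)
  then have "\<kappa> ^ card (support x) = \<kappa> * \<kappa> ^ (card (support x) - 1)"
    by (simp flip: power_Suc)
  ultimately show ?thesis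
    using assms(1) by (simp add: composition_weight_def mult_ac)
qed

lemma composition_weight_mult_power:
  assumes "finite S" "support x \<subseteq> S"
  shows "composition_weight \<kappa> (\<lambda>j c. w j c * u j ^ c) x =
    composition_weight \<kappa> w x * (\<Prod>j\<in>S. u j ^ x j)"
proof -
  have "(\<Prod>j\<in>support x. u j ^ x j) = (\<Prod>j\<in>S. u j ^ x j)"
    using assms by (intro prod.mono_neutral_left) (auto simp: support_def)
  then show ?thesis
    by (simp add: composition_weight_def prod.distrib mult.assoc)
qed

definition composition_sum :: "'a::comm_semiring_1 \<Rightarrow> ('b \<Rightarrow> nat \<Rightarrow> 'a) \<Rightarrow> 'b set \<Rightarrow> nat \<Rightarrow> 'a" where
  "composition_sum \<kappa> w S b = (\<Sum>x\<in>weak_compositions S b. composition_weight \<kappa> w x)"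

lemma composition_sum_insert:
  assumes "finite S" "s \<notin> S" "b > 0"
  shows "composition_sum \<kappa> w (insert s S) b =
    composition_sum \<kappa> w S b + \<kappa> * (\<Sum>c\<in>{1..<b}. composition_sum \<kappa> w S (b - c) * w s c) + w s b"
proof -
  define part where
    "part c = (\<Sum>x\<in>weak_compositions S (b - c). composition_weight \<kappa> w (x(s := c)))" for c
  have vanish: "x s = 0" if "x \<in> weak_compositions S c" for x c
    using that assms(2) by (auto simp: weak_compositions_def support_def)
  have "part 0 = composition_sum \<kappa> w S b"
    unfolding part_def composition_sum_def by (intro sum.cong) (auto simp: vanish fun_upd_idem)
  moreover have "part b = w s b"
    using assms by (simp add: part_def weak_compositions_zero composition_weight_single)
  moreover have "part c = \<kappa> * (composition_sum \<kappa> w S (b - c) * w s c)" if "c \<in> {1..<b}" for c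
  proof -
    have "composition_weight \<kappa> w (x(s := c)) = \<kappa> * (composition_weight \<kappa> w x * w s c)"
      if x: "x \<in> weak_compositions S (b - c)" for x
    proof (rule composition_weight_update)
      show "finite (support x)"
        using x assms(1) by (auto simp: weak_compositions_def intro: finite_subset)
      show "x \<noteq> (\<lambda>_. 0)"
        using weak_compositions_nonzero[OF x] \<open>c \<in> {1..<b}\<close> by simp
    qed (use vanish[OF x] \<open>c \<in> {1..<b}\<close> in auto)
    then show ?thesis
      by (simp add: part_def composition_sum_def sum_distrib_left sum_distrib_right)
  qed
  moreover have "{..b} = insert 0 (insert b {1..<b})"
    using assms(3) by auto
  then have "(\<Sum>c\<le>b. part c) = part 0 + (\<Sum>c\<in>{1..<b}. part c) + part b"
    using assms(3) by (simp add: ac_simps)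
  ultimately show ?thesis
    using sum_weak_compositions_insert[OF assms(1,2), of "composition_weight \<kappa> w" b]
    by (simp add: composition_sum_def part_def sum_distrib_left)
qed

definition vertex_factor :: "'a::field \<Rightarrow> nat \<Rightarrow> nat \<Rightarrow> 'a" where
  "vertex_factor q d b = q ^ (d * (b - 1)) * q_int q d"

lemma vertex_factor_add:
  assumes "b > 0"
  shows "vertex_factor q d (b + c) = vertex_factor q d b * (q ^ d) ^ c"
proof -
  have "b + c - 1 = (b - 1) + c"
    using assms by simp
  then show ?thesis
    by (simp add: vertex_factor_def distrib_left power_add power_mult)
qed

lemma vertex_factor_nat:
  assumes "b > 0"
  shows "vertex_factor q d (nat b) = q powi (int d * (b - 1)) * q_int q d"
proof -
  have "int d * (b - 1) = int (d * (nat b - 1))"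
    using assms by simp
  then show ?thesis
    by (simp only: vertex_factor_def power_int_of_nat)
qed

text \<open>Multiplied by \<open>q - 1\<close>, this says that the generating function
  \<open>\<Prod>j<m. (1 - q ^ j * z) / (1 - q ^ (j + 1) * z)\<close> telescopes to \<open>(1 - z) / (1 - q ^ m * z)\<close>.\<close>

lemma composition_sum_q_powers:
  fixes q :: "'a::field"
  assumes "b > 0"
  shows "composition_sum (q - 1) (\<lambda>j c. q ^ (c - 1) * (q ^ j) ^ c) {..<m} b =
    vertex_factor q m b"
    (is "composition_sum _ ?w _ _ = _")
  using assms
proof (induction m arbitrary: b)
  case 0
  then show ?case
    by (simp add: composition_sum_def weak_compositions_empty vertex_factor_def q_int_def)
next
  case (Suc m)
  let ?R = "composition_sum (q - 1) ?w {..<m}"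
  obtain e where b: "b = Suc e"
    using Suc.prems gr0_implies_Suc by blast
  have "?R (b - c) * ?w m c = vertex_factor q m b * q ^ (c - 1)" if "c \<in> {1..<b}" for c
    using that Suc.IH[of "b - c"] vertex_factor_add[of "b - c" q m c] by (simp add: mult_ac)
  then have "(\<Sum>c\<in>{1..<b}. ?R (b - c) * ?w m c) =
      vertex_factor q m b * (\<Sum>c\<in>{1..<b}. q ^ (c - 1))"
    unfolding sum_distrib_left by (intro sum.cong refl)
  also have "(\<Sum>c\<in>{1..<b}. q ^ (c - 1)) = (\<Sum>i<e. q ^ i)"
    unfolding b by (rule sum.reindex_bij_witness[where i = Suc and j = "\<lambda>c. c - 1"]) auto
  finally have middle: "(q - 1) * (\<Sum>c\<in>{1..<b}. ?R (b - c) * ?w m c) =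
      vertex_factor q m b * (q ^ e - 1)"
    by (simp add: power_diff_1_eq)
  have "composition_sum (q - 1) ?w {..<Suc m} b =
      vertex_factor q m b + vertex_factor q m b * (q ^ e - 1) + q ^ e * (q ^ m) ^ b"
    using composition_sum_insert[of "{..<m}" m b "q - 1" ?w] Suc.IH[OF Suc.prems] Suc.prems middle
    by (simp add: b lessThan_Suc)
  also have "\<dots> = vertex_factor q (Suc m) b"
    by (simp add: b vertex_factor_def q_int_def power_add algebra_simps flip: power_mult)
  finally show ?case .
qed

section \<open>Natural-number flows\<close>

text \<open>Arcs are meant to point downwards, so vertex \<open>k\<close> only receives flow from \<open>i > k\<close>. Building this
  into the inflow makes the hypothesis \<open>N k \<subseteq> {..<k}\<close> superfluous.\<close>

definition nat_flows :: "(nat \<Rightarrow> nat set) \<Rightarrow> nat \<Rightarrow> (nat \<Rightarrow> nat) \<Rightarrow> (nat \<Rightarrow> nat \<Rightarrow> nat) set" where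
  "nat_flows N n a =
    {f. (\<forall>k\<in>{1..n}. f k \<in> weak_compositions (N k) (a k + (\<Sum>i\<in>{k<..n}. f i k))) \<and>
      (\<forall>k. k \<notin> {1..n} \<longrightarrow> f k = (\<lambda>_. 0))}"

lemma nat_flows_0: "nat_flows N 0 a = {\<lambda>_ _. 0}"
  by (auto simp: nat_flows_def)

lemma nat_flows_Suc_iff:
  "f \<in> nat_flows N (Suc n) a \<longleftrightarrow>
    f (Suc n) \<in> weak_compositions (N (Suc n)) (a (Suc n)) \<and>
    f(Suc n := \<lambda>_. 0) \<in> nat_flows N n (\<lambda>k. a k + f (Suc n) k)"
proof -
  have "(\<Sum>i\<in>{k<..Suc n}. f i k) = f (Suc n) k + (\<Sum>i\<in>{k<..n}. (f(Suc n := \<lambda>_. 0)) i k)"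
    if "k \<in> {1..n}" for k
  proof -
    have "{k<..Suc n} = insert (Suc n) {k<..n}"
      using that by auto
    moreover have "(\<Sum>i\<in>{k<..n}. f i k) = (\<Sum>i\<in>{k<..n}. (f(Suc n := \<lambda>_. 0)) i k)"
      by (intro sum.cong) auto
    ultimately show ?thesis by simp
  qed
  then show ?thesis
    by (auto simp: nat_flows_def atLeastAtMostSuc_conv add.assoc)
qed

lemma bij_betw_nat_flows_Suc:
  "bij_betw (\<lambda>(x, f). f(Suc n := x))
    (SIGMA x:weak_compositions (N (Suc n)) (a (Suc n)). nat_flows N n (\<lambda>k. a k + x k))
    (nat_flows N (Suc n) a)"
proof (rule bij_betw_byWitness[where f' = "\<lambda>f. (f (Suc n), f(Suc n := \<lambda>_. 0))"])
  have vanish: "f(Suc n := \<lambda>_. 0) = f" if "f \<in> nat_flows N n a" for f a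
    using that by (simp add: nat_flows_def fun_upd_idem)
  show "\<forall>p\<in>SIGMA x:weak_compositions (N (Suc n)) (a (Suc n)). nat_flows N n (\<lambda>k. a k + x k).
      (\<lambda>f. (f (Suc n), f(Suc n := \<lambda>_. 0))) ((\<lambda>(x, f). f(Suc n := x)) p) = p"
    by (auto simp: vanish)
  show "(\<lambda>(x, f). f(Suc n := x)) `
      (SIGMA x:weak_compositions (N (Suc n)) (a (Suc n)). nat_flows N n (\<lambda>k. a k + x k))
      \<subseteq> nat_flows N (Suc n) a"
    by (auto simp: nat_flows_Suc_iff vanish)
qed (auto simp: nat_flows_Suc_iff)

lemma finite_nat_flows:
  assumes "\<And>k. finite (N k)"
  shows "finite (nat_flows N n a)"
proof (induction n arbitrary: a)
  case 0
  show ?case by (simp add: nat_flows_0)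
next
  case (Suc n)
  have "finite (SIGMA x:weak_compositions (N (Suc n)) (a (Suc n)). nat_flows N n (\<lambda>k. a k + x k))"
    using Suc.IH finite_weak_compositions[OF assms] by blast
  then show ?case
    using bij_betw_finite[OF bij_betw_nat_flows_Suc] by blast
qed

definition weighted_flow_sum ::
  "'a::comm_semiring_1 \<Rightarrow> (nat \<Rightarrow> 'a) \<Rightarrow> (nat \<Rightarrow> nat set) \<Rightarrow> nat \<Rightarrow> (nat \<Rightarrow> nat) \<Rightarrow> 'a" where
  "weighted_flow_sum \<kappa> w N n a =
    (\<Sum>f\<in>nat_flows N n a. \<Prod>k=1..n. composition_weight \<kappa> (\<lambda>_. w) (f k))"

lemma weighted_flow_sum_0: "weighted_flow_sum \<kappa> w N 0 a = 1"
  by (simp add: weighted_flow_sum_def nat_flows_0)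

lemma weighted_flow_sum_Suc:
  assumes "\<And>k. finite (N k)"
  shows "weighted_flow_sum \<kappa> w N (Suc n) a =
    (\<Sum>x\<in>weak_compositions (N (Suc n)) (a (Suc n)).
      composition_weight \<kappa> (\<lambda>_. w) x * weighted_flow_sum \<kappa> w N n (\<lambda>k. a k + x k))"
proof -
  define W where "W n f = (\<Prod>k=1..n. composition_weight \<kappa> (\<lambda>_. w) (f k))"
    for n and f :: "nat \<Rightarrow> nat \<Rightarrow> nat"
  have W_update: "W (Suc n) (f(Suc n := x)) = composition_weight \<kappa> (\<lambda>_. w) x * W n f" for f x
  proof -
    have "(\<Prod>k=1..n. composition_weight \<kappa> (\<lambda>_. w) ((f(Suc n := x)) k)) = W n f"
      unfolding W_def by (intro prod.cong) auto
    then show ?thesis by (simp add: W_def mult.commute)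
  qed
  have "weighted_flow_sum \<kappa> w N (Suc n) a =
      (\<Sum>x\<in>weak_compositions (N (Suc n)) (a (Suc n)).
        \<Sum>f\<in>nat_flows N n (\<lambda>k. a k + x k). W (Suc n) (f(Suc n := x)))"
    using sum.reindex_bij_betw[OF bij_betw_nat_flows_Suc, of "W (Suc n)" n N a]
    by (simp add: weighted_flow_sum_def W_def sum.Sigma finite_weak_compositions assms
        finite_nat_flows case_prod_unfold)
  then show ?thesis
    by (simp only: W_update) (simp add: weighted_flow_sum_def W_def sum_distrib_left)
qed

lemma prod_powers_initial_segment:
  fixes q :: "'a::comm_semiring_1"
  assumes "m \<le> Suc n" "\<And>j. j < m \<Longrightarrow> d j = j" "support x \<subseteq> {..<m}"
  shows "(\<Prod>k=1..n. (q ^ d k) ^ x k) = (\<Prod>j<m. (q ^ j) ^ x j)"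
proof (rule prod.mono_neutral_cong)
  show "(q ^ j) ^ x j = 1" if "j \<in> {..<m} - {1..n}" for j
    using that assms(1) by (cases "j = 0") auto
  show "(q ^ d k) ^ x k = 1" if "k \<in> {1..n} - {..<m}" for k
    using that assms(3) by (cases "x k = 0") (auto simp: support_def)
qed (use assms(2) in auto)

lemma weighted_flow_sum_initial_segments:
  fixes q :: "'a::field"
  assumes "\<And>j k. k \<le> n \<Longrightarrow> j < d k \<Longrightarrow> d j = j"
    and "\<And>k. k \<in> {1..n} \<Longrightarrow> a k > 0"
  shows "weighted_flow_sum (q - 1) (\<lambda>c. q ^ (c - 1)) (\<lambda>k. {..<d k}) n a =
    (\<Prod>k=1..n. vertex_factor q (d k) (a k))"
  using assms
proof (induction n arbitrary: a)
  case 0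
  show ?case by (simp add: weighted_flow_sum_0)
next
  case (Suc n)
  let ?S = "{..<d (Suc n)}" and ?w = "\<lambda>c. q ^ (c - 1)"
  let ?P = "\<Prod>k=1..n. vertex_factor q (d k) (a k)"
  have "composition_weight (q - 1) (\<lambda>_. ?w) x *
      weighted_flow_sum (q - 1) ?w (\<lambda>k. {..<d k}) n (\<lambda>k. a k + x k) =
      ?P * composition_weight (q - 1) (\<lambda>j c. ?w c * (q ^ j) ^ c) x"
    if "x \<in> weak_compositions ?S (a (Suc n))" for x
  proof -
    have x: "support x \<subseteq> ?S"
      using that by (simp add: weak_compositions_def)
    have "weighted_flow_sum (q - 1) ?w (\<lambda>k. {..<d k}) n (\<lambda>k. a k + x k) =
        (\<Prod>k=1..n. vertex_factor q (d k) (a k + x k))"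
      by (rule Suc.IH) (use Suc.prems(1)[OF le_SucI] Suc.prems(2) in auto)
    also have "\<dots> = ?P * (\<Prod>k=1..n. (q ^ d k) ^ x k)"
      using Suc.prems(2) by (simp add: vertex_factor_add prod.distrib)
    also have "(\<Prod>k=1..n. (q ^ d k) ^ x k) = (\<Prod>j\<in>?S. (q ^ j) ^ x j)"
    proof (rule prod_powers_initial_segment[OF _ _ x])
      show "d (Suc n) \<le> Suc n"
        using Suc.prems(1)[of "Suc n" "Suc n"] by force
    qed (use Suc.prems(1)[of "Suc n"] in auto)
    finally show ?thesis
      unfolding composition_weight_mult_power[OF finite_lessThan x]
      by (simp only: mult.left_commute)
  qed
  then have "weighted_flow_sum (q - 1) ?w (\<lambda>k. {..<d k}) (Suc n) a =
      ?P * composition_sum (q - 1) (\<lambda>j c. ?w c * (q ^ j) ^ c) ?S (a (Suc n))"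
    unfolding weighted_flow_sum_Suc[OF finite_lessThan] composition_sum_def sum_distrib_left
    by (intro sum.cong refl)
  also have "\<dots> = (\<Prod>k=1..Suc n. vertex_factor q (d k) (a k))"
    using composition_sum_q_powers[of "a (Suc n)" q "d (Suc n)"] Suc.prems(2)[of "Suc n"] by simp
  finally show ?case .
qed

section \<open>Neighbourhoods\<close>

definition neighbours :: "'v set set \<Rightarrow> 'v \<Rightarrow> 'v set" where
  "neighbours E v = {w. {v, w} \<in> E}"

lemma mem_neighbours_commute: "w \<in> neighbours E v \<longleftrightarrow> v \<in> neighbours E w"
  by (simp add: neighbours_def insert_commute)

lemma neighbours_subset:
  assumes "E \<subseteq> [V]\<^bsup>2\<^esup>"
  shows "neighbours E v \<subseteq> V - {v}"
proof
  fix w assume "w \<in> neighbours E v"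
  then have "{v, w} \<in> [V]\<^bsup>2\<^esup>"
    using assms unfolding neighbours_def by blast
  then show "w \<in> V - {v}"
    unfolding doubleton_in_nsets_2 by blast
qed

lemma degree_eq_card_neighbours:
  assumes "E \<subseteq> [V]\<^bsup>2\<^esup>"
  shows "degree E v = card (neighbours E v)"
proof -
  have "e \<in> (\<lambda>w. {v, w}) ` neighbours E v" if "e \<in> E" "v \<in> e" for e
    using that assms by (auto simp: neighbours_def insert_commute elim!: nsets2_E dest!: subsetD)
  then have "bij_betw (\<lambda>w. {v, w}) (neighbours E v) {e \<in> E. v \<in> e}"
    by (auto simp: bij_betw_def inj_on_def doubleton_eq_iff neighbours_def)
  then show ?thesis
    by (simp add: degree_def bij_betw_same_card)
qed

definition lower_neighbours :: "nat set set \<Rightarrow> nat \<Rightarrow> nat set" where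
  "lower_neighbours E k = {j \<in> neighbours E k. j < k}"

lemma finite_lower_neighbours: "finite (lower_neighbours E k)"
  by (simp add: lower_neighbours_def)

lemma dbar_eq_card_lower_neighbours: "dbar E k = card (lower_neighbours E k)"
  by (simp add: dbar_def lower_neighbours_def neighbours_def conj_commute)

section \<open>Lattice points of flow polytopes\<close>

lemma mem_arcs_iff: "(i, j) \<in> arcs E \<longleftrightarrow> j \<in> lower_neighbours E i"
  by (auto simp: arcs_def lower_neighbours_def neighbours_def)

definition real_flow :: "nat set set \<Rightarrow> (nat \<Rightarrow> nat \<Rightarrow> nat) \<Rightarrow> nat \<times> nat \<Rightarrow> real" where
  "real_flow E f = (\<lambda>(i, j)\<in>arcs E. real (f i j))"

lemma real_flow_mem_PiE: "real_flow E f \<in> arcs E \<rightarrow>\<^sub>E {0..}"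
  by (auto simp: real_flow_def)

lemma real_flow_apply: "j \<in> lower_neighbours E i \<Longrightarrow> real_flow E f (i, j) = real (f i j)"
  by (simp add: real_flow_def mem_arcs_iff)

lemma inj_on_real_flow: "inj_on (real_flow E) {f. \<forall>k. support (f k) \<subseteq> lower_neighbours E k}"
proof (intro inj_onI ext)
  fix f g i j
  assume "f \<in> {f. \<forall>k. support (f k) \<subseteq> lower_neighbours E k}"
    and "g \<in> {f. \<forall>k. support (f k) \<subseteq> lower_neighbours E k}"
    and eq: "real_flow E f = real_flow E g"
  then have vanish: "f i j = 0 \<and> g i j = 0" if "j \<notin> lower_neighbours E i"
    using that by (auto simp: support_def)
  show "f i j = g i j"
  proof (cases "j \<in> lower_neighbours E i")
    case True
    then show ?thesis
      using fun_cong[OF eq, of "(i, j)"] by (simp add: real_flow_apply)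
  qed (simp add: vanish)
qed

lemma integral_flow_eq_real_flow:
  assumes "x \<in> arcs E \<rightarrow>\<^sub>E {0..}" "\<forall>e\<in>arcs E. x e \<in> \<int>"
  obtains f where "\<And>k. support (f k) \<subseteq> lower_neighbours E k" "x = real_flow E f"
proof
  define f where "f i j = (if j \<in> lower_neighbours E i then nat \<lfloor>x (i, j)\<rfloor> else 0)" for i j
  show "support (f k) \<subseteq> lower_neighbours E k" for k
    by (auto simp: support_def f_def)
  have "x (i, j) = real (nat \<lfloor>x (i, j)\<rfloor>)" if "(i, j) \<in> arcs E" for i j
  proof -
    have "x (i, j) \<ge> 0" "x (i, j) \<in> \<int>"
      using assms that by (auto simp: PiE_iff)
    then show ?thesis by (auto elim!: Ints_cases)
  qed
  then show "x = real_flow E f"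
    using assms(1)
    by (intro extensionalityI[of _ "arcs E"]) (auto simp: PiE_iff real_flow_def f_def mem_arcs_iff)
qed

context
  fixes n :: nat and E :: "nat set set"
  assumes edges: "E \<subseteq> [{0..n}]\<^bsup>2\<^esup>"
begin

lemma lower_neighbours_outside: "k \<notin> {1..n} \<Longrightarrow> lower_neighbours E k = {}"
  using edges by (force simp: lower_neighbours_def neighbours_def)

lemma arcs_eq_Sigma: "arcs E = (SIGMA k:{1..n}. lower_neighbours E k)"
  using lower_neighbours_outside by (force simp: mem_arcs_iff)

lemma finite_arcs: "finite (arcs E)"
  by (simp add: arcs_eq_Sigma finite_lower_neighbours)

lemma sum_net_flow: "(\<Sum>k=0..n. net_flow E x k) = 0"
proof -
  have "fst ` arcs E \<subseteq> {0..n}" "snd ` arcs E \<subseteq> {0..n}"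
    by (auto simp: arcs_eq_Sigma lower_neighbours_def)
  then show ?thesis
    by (simp add: net_flow_def sum_subtractf sum.group finite_arcs)
qed

lemma mem_flow_polytope_iff:
  "x \<in> flow_polytope n E a \<longleftrightarrow>
    x \<in> arcs E \<rightarrow>\<^sub>E {0..} \<and> (\<forall>k\<in>{1..n}. net_flow E x k = of_int (a k))"
proof -
  have "net_flow E x 0 = - of_int (\<Sum>i=1..n. a i)"
    if "\<forall>k\<in>{1..n}. net_flow E x k = of_int (a k)"
    using sum_net_flow[of x] that by (simp add: sum.atLeast_Suc_atMost)
  then show ?thesis
    by (auto simp: flow_polytope_def)
qed

lemma net_flow_real_flow:
  assumes supp: "\<And>k. support (f k) \<subseteq> lower_neighbours E k"
  shows "net_flow E (real_flow E f) k =
    real (sum (f k) (lower_neighbours E k)) - real (\<Sum>i\<in>{k<..n}. f i k)"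
proof -
  have "(\<Sum>e\<in>{e \<in> arcs E. fst e = k}. real_flow E f e) =
      (\<Sum>j\<in>lower_neighbours E k. real (f k j))"
    by (rule sum.reindex_bij_witness[where i = "Pair k" and j = snd])
      (auto simp: mem_arcs_iff real_flow_apply)
  moreover have "(\<Sum>e\<in>{e \<in> arcs E. snd e = k}. real_flow E f e) =
      (\<Sum>i\<in>{i \<in> {k<..n}. k \<in> lower_neighbours E i}. real (f i k))"
    by (rule sum.reindex_bij_witness[where i = "\<lambda>i. (i, k)" and j = fst])
      (auto simp: arcs_eq_Sigma real_flow_apply lower_neighbours_def mem_arcs_iff)
  moreover have "\<dots> = (\<Sum>i\<in>{k<..n}. real (f i k))"
    using supp by (intro sum.mono_neutral_left) (auto simp: support_def)
  ultimately show ?thesis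
    by (simp add: net_flow_def)
qed

lemma real_flow_mem_flow_polytope_iff:
  assumes supp: "\<And>k. support (f k) \<subseteq> lower_neighbours E k"
    and nonneg: "\<And>k. k \<in> {1..n} \<Longrightarrow> a k \<ge> 0"
  shows "real_flow E f \<in> flow_polytope n E a \<longleftrightarrow>
    f \<in> nat_flows (lower_neighbours E) n (\<lambda>k. nat (a k))"
proof -
  have "net_flow E (real_flow E f) k = of_int (a k) \<longleftrightarrow>
      sum (f k) (lower_neighbours E k) = nat (a k) + (\<Sum>i\<in>{k<..n}. f i k)"
    if "k \<in> {1..n}" for k
  proof -
    have "of_int (a k) = real (nat (a k))"
      using nonneg[OF that] by simp
    then show ?thesis
      by (simp only: net_flow_real_flow[OF supp] diff_eq_eq of_nat_eq_iff flip: of_nat_add)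
  qed
  moreover have "f k = (\<lambda>_. 0)" if "k \<notin> {1..n}" for k
    using supp[of k] lower_neighbours_outside[OF that] by (simp add: support_eq_empty_iff)
  ultimately show ?thesis
    using supp
    by (auto simp: mem_flow_polytope_iff real_flow_mem_PiE nat_flows_def weak_compositions_def)
qed

lemma support_nat_flow:
  assumes "f \<in> nat_flows (lower_neighbours E) n b"
  shows "support (f k) \<subseteq> lower_neighbours E k"
  using assms by (cases "k \<in> {1..n}") (auto simp: nat_flows_def weak_compositions_def)

lemma bij_betw_real_flow:
  assumes nonneg: "\<And>k. k \<in> {1..n} \<Longrightarrow> a k \<ge> 0"
  shows "bij_betw (real_flow E) (nat_flows (lower_neighbours E) n (\<lambda>k. nat (a k)))
    (flow_polytope n E a \<inter> {x. \<forall>e\<in>arcs E. x e \<in> \<int>})"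
  unfolding bij_betw_def
proof (intro conjI equalityI subsetI)
  show "inj_on (real_flow E) (nat_flows (lower_neighbours E) n (\<lambda>k. nat (a k)))"
    by (rule inj_on_subset[OF inj_on_real_flow]) (use support_nat_flow in blast)
next
  fix x assume "x \<in> real_flow E ` nat_flows (lower_neighbours E) n (\<lambda>k. nat (a k))"
  then obtain f where f: "f \<in> nat_flows (lower_neighbours E) n (\<lambda>k. nat (a k))" "x = real_flow E f"
    by blast
  then show "x \<in> flow_polytope n E a \<inter> {x. \<forall>e\<in>arcs E. x e \<in> \<int>}"
    using real_flow_mem_flow_polytope_iff[OF support_nat_flow[OF f(1)] nonneg]
    by (auto simp: mem_arcs_iff real_flow_apply)
next
  fix x assume x: "x \<in> flow_polytope n E a \<inter> {x. \<forall>e\<in>arcs E. x e \<in> \<int>}"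
  then obtain f where f: "\<And>k. support (f k) \<subseteq> lower_neighbours E k" "x = real_flow E f"
    using integral_flow_eq_real_flow by (auto simp: mem_flow_polytope_iff)
  then show "x \<in> real_flow E ` nat_flows (lower_neighbours E) n (\<lambda>k. nat (a k))"
    using x real_flow_mem_flow_polytope_iff[OF f(1) nonneg] by auto
qed

lemma wt_flow_real_flow:
  fixes q t :: "'a::field"
  assumes supp: "\<And>k. support (f k) \<subseteq> lower_neighbours E k"
    and nonzero: "\<And>k. k \<in> {1..n} \<Longrightarrow> f k \<noteq> (\<lambda>_. 0)"
  shows "wt_flow q t n E (real_flow E f) =
    (\<Prod>k=1..n. composition_weight (- ((1 - t) * (1 - q))) (\<lambda>_. wt q t) (f k))"
proof -
  have fin: "finite (support (f k))" for k
    using finite_subset[OF supp finite_lower_neighbours] .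
  have pos: "card (support (f k)) > 0" if "k \<in> {1..n}" for k
    using nonzero[OF that] fin by (simp add: card_gt_0_iff support_eq_empty_iff)
  have "{e \<in> arcs E. real_flow E f e > 0} = (SIGMA k:{1..n}. support (f k))"
    using supp by (fastforce simp: arcs_eq_Sigma real_flow_apply support_def)
  then have "int (card {e \<in> arcs E. real_flow E f e > 0}) - int n =
      (\<Sum>k=1..n. int (card (support (f k))) - 1)"
    using fin by (simp add: sum_subtractf)
  also have "\<dots> = int (\<Sum>k=1..n. card (support (f k)) - 1)"
    using pos by (simp add: of_nat_diff Suc_le_eq)
  finally have exponent: "int (card {e \<in> arcs E. real_flow E f e > 0}) - int n =
      int (\<Sum>k=1..n. card (support (f k)) - 1)" .
  have "(\<Prod>e\<in>arcs E. wt q t (nat \<lfloor>real_flow E f e\<rfloor>)) =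
      (\<Prod>k=1..n. \<Prod>j\<in>lower_neighbours E k. wt q t (f k j))"
    by (simp add: arcs_eq_Sigma prod.Sigma finite_lower_neighbours case_prod_unfold real_flow_def)
  also have "\<dots> = (\<Prod>k=1..n. \<Prod>j\<in>support (f k). wt q t (f k j))"
    using supp by (intro prod.cong prod.mono_neutral_right)
      (auto simp: finite_lower_neighbours support_def wt_def)
  finally show ?thesis
    by (simp add: wt_flow_def exponent composition_weight_def prod.distrib power_sum
        del: of_nat_sum)
qed

lemma Ehr_eq_weighted_flow_sum:
  fixes q t :: "'a::field"
  assumes pos: "\<And>k. k \<in> {1..n} \<Longrightarrow> a k > 0"
  shows "Ehr q t n E a =
    weighted_flow_sum (- ((1 - t) * (1 - q))) (wt q t) (lower_neighbours E) n (\<lambda>k. nat (a k))"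
proof -
  let ?F = "nat_flows (lower_neighbours E) n (\<lambda>k. nat (a k))"
  have "Ehr q t n E a = (\<Sum>f\<in>?F. wt_flow q t n E (real_flow E f))"
    unfolding Ehr_def
    by (rule sum.reindex_bij_betw[symmetric], rule bij_betw_real_flow) (use pos in force)
  also have "\<dots> = (\<Sum>f\<in>?F. \<Prod>k=1..n. composition_weight (- ((1 - t) * (1 - q))) (\<lambda>_. wt q t) (f k))"
  proof (rule sum.cong)
    fix f assume f: "f \<in> ?F"
    have "f k \<noteq> (\<lambda>_. 0)" if "k \<in> {1..n}" for k
      using f that pos[OF that]
      by (intro weak_compositions_nonzero) (auto simp: nat_flows_def)
    then show "wt_flow q t n E (real_flow E f) =
        (\<Prod>k=1..n. composition_weight (- ((1 - t) * (1 - q))) (\<lambda>_. wt q t) (f k))"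
      using wt_flow_real_flow support_nat_flow[OF f] by blast
  qed simp
  finally show ?thesis
    by (simp add: weighted_flow_sum_def)
qed

end

lemma wt_zero_right: "q \<noteq> 0 \<Longrightarrow> wt q 0 = (\<lambda>c. q ^ (c - 1))"
  by (auto simp: wt_def fun_eq_iff power_diff zero_power)

section \<open>Threshold graphs\<close>

lemma threshold_graph_finite: "threshold_graph V E \<Longrightarrow> finite V"
  by (induction rule: threshold_graph.induct) auto

lemma threshold_graph_edges: "threshold_graph V E \<Longrightarrow> E \<subseteq> [V]\<^bsup>2\<^esup>"
proof (induction rule: threshold_graph.induct)
  case (isolated V E v)
  then show ?case using nsets_mono[of V "insert v V" 2] by blast
next
  case (dominating V E v)
  then show ?case using nsets_mono[of V "insert v V" 2] by auto
qed simp

lemma threshold_graph_neighbours_nested: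
  assumes "threshold_graph V E"
  shows "neighbours E u - {v} \<subseteq> neighbours E v \<or> neighbours E v - {u} \<subseteq> neighbours E u"
  using assms
proof (induction rule: threshold_graph.induct)
  case (dominating V E z)
  let ?E = "E \<union> {{u, z} |u. u \<in> V}"
  have "neighbours E x \<subseteq> V - {x}" for x
    using neighbours_subset[OF threshold_graph_edges[OF dominating.hyps(1)]] .
  moreover have "neighbours E x = {}" if "x \<notin> V" for x
    using calculation that mem_neighbours_commute by fast
  moreover have
    "neighbours ?E x = neighbours E x \<union> (if x = z then V else if x \<in> V then {z} else {})" for x
    by (auto simp: neighbours_def doubleton_eq_iff)
  ultimately show ?case
    using dominating.IH dominating.hyps(2) by auto
qed (auto simp: neighbours_def)

lemma threshold_graph_neighbours_subset:
  assumes threshold: "threshold_graph V E" and deg: "degree E v \<le> degree E u"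
  shows "neighbours E v - {u} \<subseteq> neighbours E u"
  using threshold_graph_neighbours_nested[OF threshold, of u v]
proof
  assume nested: "neighbours E u - {v} \<subseteq> neighbours E v"
  note edges = threshold_graph_edges[OF threshold]
  have fin: "finite (neighbours E x)" for x
    using neighbours_subset[OF edges] threshold_graph_finite[OF threshold] finite_subset by blast
  have "neighbours E u - {v} \<subseteq> neighbours E v - {u}"
    using nested neighbours_subset[OF edges] by blast
  moreover have "card (neighbours E v - {u}) \<le> card (neighbours E u - {v})"
    using deg mem_neighbours_commute[of u E v]
    by (simp add: degree_eq_card_neighbours[OF edges] card_Diff_singleton_if diff_le_mono)
  ultimately have "neighbours E u - {v} = neighbours E v - {u}"
    by (intro card_seteq) (simp_all add: fin)
  then show ?thesis by blast
qed

lemma down_closed_eq_lessThan_card: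
  fixes S :: "nat set"
  assumes "finite S" "\<And>i j. j \<in> S \<Longrightarrow> i < j \<Longrightarrow> i \<in> S"
  shows "S = {..<card S}"
proof -
  define k where "k = (LEAST k. k \<notin> S)"
  have "k \<notin> S"
    unfolding k_def using ex_new_if_finite[OF infinite_UNIV_nat assms(1)] by (rule LeastI_ex)
  moreover have "i \<in> S" if "i < k" for i
    using not_less_Least that unfolding k_def by blast
  ultimately have "S = {..<k}"
    using assms(2) by (metis lessThan_iff linorder_neqE_nat set_eqI)
  then show ?thesis by simp
qed

context
  fixes n :: nat and E :: "nat set set"
  assumes threshold: "threshold_graph {0..n} E" and labeled: "reverse_degree_labeled n E"
begin

lemma adjacent_down_closed:
  assumes "{i, j} \<in> E" "k < j" "k \<noteq> i"
  shows "{i, k} \<in> E"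
proof -
  have "j \<le> n"
    using assms(1) threshold_graph_edges[OF threshold] by auto
  then have "degree E j \<le> degree E k"
    using labeled assms(2) by (simp add: reverse_degree_labeled_def)
  then show ?thesis
    using threshold_graph_neighbours_subset[OF threshold, of j k] assms
    by (auto simp: neighbours_def insert_commute)
qed

lemma lower_neighbours_eq_lessThan: "lower_neighbours E k = {..<dbar E k}"
  unfolding dbar_eq_card_lower_neighbours
  by (rule down_closed_eq_lessThan_card[OF finite_lower_neighbours])
    (use adjacent_down_closed in \<open>auto simp: lower_neighbours_def neighbours_def\<close>)

lemma dbar_eq_self:
  assumes "{i, k} \<in> E" "i < k"
  shows "dbar E i = i"
proof -
  have "lower_neighbours E i = {..<i}"
    using adjacent_down_closed[OF assms(1)] assms(2)
    by (auto simp: lower_neighbours_def neighbours_def)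
  then show ?thesis
    by (simp add: dbar_eq_card_lower_neighbours)
qed

lemma dbar_eq_self_if_less_dbar: "j < dbar E k \<Longrightarrow> dbar E j = j"
  using lower_neighbours_eq_lessThan[of k]
  by (intro dbar_eq_self[of j k]) (auto simp: lower_neighbours_def neighbours_def insert_commute)

lemma dbar_eq_min: "dbar E i = min (degree E i) i"
proof -
  have neighbours: "neighbours E i \<subseteq> {0..n} - {i}" "degree E i = card (neighbours E i)"
    using threshold_graph_edges[OF threshold]
    by (simp_all only: neighbours_subset degree_eq_card_neighbours)
  show ?thesis
  proof (cases "\<exists>k>i. {i, k} \<in> E")
    case True
    then have dbar: "dbar E i = i"
      using dbar_eq_self by blast
    have "finite (neighbours E i)"
      using neighbours(1) finite_subset by blast
    then have "dbar E i \<le> degree E i"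
      unfolding dbar_eq_card_lower_neighbours neighbours(2)
      by (rule card_mono) (auto simp: lower_neighbours_def)
    then show ?thesis
      using dbar by simp
  next
    case False
    then have "neighbours E i = lower_neighbours E i"
      using neighbours(1)
      by (force simp: neighbours_def lower_neighbours_def not_less le_less)
    then have "dbar E i = degree E i"
      by (simp add: dbar_eq_card_lower_neighbours neighbours(2))
    moreover have "dbar E i \<le> i"
      using card_mono[of "{..<i}" "lower_neighbours E i"]
      by (auto simp: dbar_eq_card_lower_neighbours lower_neighbours_def)
    ultimately show ?thesis by simp
  qed
qed

end

theorem theorem4p2:
  fixes n :: nat and E :: "nat set set" and a :: "nat \<Rightarrow> int" and q :: "'a::field"
  assumes "threshold_graph {0..n} E"
    and "reverse_degree_labeled n E"
    and "\<And>i. i \<in> {1..n} \<Longrightarrow> a i > 0"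
    and "q \<noteq> 0"
  shows "(\<forall>i\<in>{1..n}. dbar E i = min (degree E i) i) \<and>
    Ehr q 0 n E a = (\<Prod>i=1..n. q powi (int (dbar E i) * (a i - 1)) * q_int q (dbar E i))"
proof
  show "\<forall>i\<in>{1..n}. dbar E i = min (degree E i) i"
    using dbar_eq_min[OF assms(1,2)] by blast
  have segments: "lower_neighbours E = (\<lambda>k. {..<dbar E k})"
    using lower_neighbours_eq_lessThan[OF assms(1,2)] by (rule ext)
  have "Ehr q 0 n E a =
      weighted_flow_sum (- ((1 - 0) * (1 - q))) (wt q 0) (lower_neighbours E) n (\<lambda>k. nat (a k))"
    using threshold_graph_edges[OF assms(1)] assms(3) by (rule Ehr_eq_weighted_flow_sum)
  also have "\<dots> =
      weighted_flow_sum (q - 1) (\<lambda>c. q ^ (c - 1)) (\<lambda>k. {..<dbar E k}) n (\<lambda>k. nat (a k))"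
    by (simp add: segments wt_zero_right[OF assms(4)])
  also have "\<dots> = (\<Prod>i=1..n. vertex_factor q (dbar E i) (nat (a i)))"
    using dbar_eq_self_if_less_dbar[OF assms(1,2)] assms(3)
    by (intro weighted_flow_sum_initial_segments) auto
  also have "\<dots> = (\<Prod>i=1..n. q powi (int (dbar E i) * (a i - 1)) * q_int q (dbar E i))"
    using assms(3) by (simp add: vertex_factor_nat)
  finally show "Ehr q 0 n E a =
      (\<Prod>i=1..n. q powi (int (dbar E i) * (a i - 1)) * q_int q (dbar E i))" .
qed

end
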